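(* Let $(\mathcal M,d)$ be a metric space, $(\Omega,\mathcal F)$ a measurable space, $\epsilon>0$, and let $\hat{\mathcal A}$ be an $\epsilon$-differentially private algorithm designed for input from a subset $\mathcal H\subseteq\mathcal M$, with outputs in $(\Omega,\mathcal F)$. Then there exists a randomized algorithm $\mathcal A$ defined on the whole input space $\mathcal M$, with outputs in $(\Omega,\mathcal F)$, which is $2\epsilon$-differentially private and satisfies that for every $D\in\mathcal H$, $\mathcal A(D)\overset{d}{=}\hat{\mathcal A}(D)$.
   Context: A randomized algorithm designed for input from a set $\mathcal H'\subseteq\mathcal M$ with outputs in $(\Omega,\mathcal F)$ assigns to each $D\in\mathcal H'$ a probability distribution on $(\Omega,\mathcal F)$ (the law of $\mathcal A(D)$). It is $\epsilon$-differentially private (on $\mathcal H'$, with respect to $d$) if for all $S\in\mathcal F$ and all $D_1,D_2\in\mathcal H'$, $\mathbb P(\mathcal A(D_1)\in S)\le\exp[\epsilon\,d(D_1,D_2)]\,\mathbb P(\mathcal A(D_2)\in S)$. The symbol $\overset{d}{=}$ denotes equality of distributions. *)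

theory Defs
  imports "HOL-Probability.Probability"
begin

text \<open>
  A randomized algorithm is identified with the map sending an input to the law of its output, so
  equality in distribution is equality of measures. The measurable space of outputs is an
  Isabelle \<open>measure\<close>, of which only \<open>space\<close> and \<open>sets\<close> are used. Values of the
  map outside of the input set are irrelevant.
\<close>

definition randomized_algorithm :: "'a set \<Rightarrow> 'b measure \<Rightarrow> ('a \<Rightarrow> 'b measure) \<Rightarrow> bool" where
  "randomized_algorithm H \<Omega> A \<longleftrightarrow> (\<forall>D\<in>H. prob_space (A D) \<and> sets (A D) = sets \<Omega>)"

definition differentially_private ::
    "real \<Rightarrow> ('a \<Rightarrow> 'a \<Rightarrow> real) \<Rightarrow> 'a set \<Rightarrow> 'b measure \<Rightarrow> ('a \<Rightarrow> 'b measure) \<Rightarrow> bool" where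
  "differentially_private \<epsilon> d H \<Omega> A \<longleftrightarrow>
     (\<forall>S\<in>sets \<Omega>. \<forall>D\<^sub>1\<in>H. \<forall>D\<^sub>2\<in>H.
        measure (A D\<^sub>1) S \<le> exp (\<epsilon> * d D\<^sub>1 D\<^sub>2) * measure (A D\<^sub>2) S)"

end

theory Submission
  imports Defs
begin

text \<open>
  In the lattice of measures let \<open>\<nu> D\<close> be the infimum over \<open>D' \<in> H\<close> of the measures
  \<open>exp (\<epsilon> * d D D')\<close> times \<open>Ahat D'\<close>. The triangle inequality gives
  \<open>\<nu> D \<le> exp (\<epsilon> * d D E) * \<nu> E\<close>, and privacy of \<open>Ahat\<close> says that \<open>\<nu>\<close> agrees with
  \<open>Ahat\<close> on \<open>H\<close> and that \<open>\<nu> D\<close> dominates a positive multiple of every \<open>Ahat D'\<close>.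
  Normalising \<open>\<nu> D\<close> to total mass one costs a second factor \<open>exp (\<epsilon> * d D E)\<close>.
\<close>

text \<open>The order on measures is lexicographic: spaces come first, then sigma-algebras, and
  values only when those agree. A bound on one side therefore leaves the sigma-algebra open, while a
  sandwich fixes it.\<close>

lemma sets_eq_of_le_of_le:
  fixes L M N :: "'b measure"
  assumes "L \<le> M" "M \<le> N" "sets L = sets N"
  shows "sets M = sets N"
proof -
  have sp: "space L = space N"
    using assms(3) by (rule sets_eq_imp_space_eq)
  then have "space M = space L" "space M = space N"
    using le_measureD1[OF assms(1)] le_measureD1[OF assms(2)] by auto
  then show ?thesis
    using le_measureD2[OF assms(1)] le_measureD2[OF assms(2)] assms(3) by auto
qed

text \<open>Translates between the lattice order, where infima are formed, and the real inequalities
  in which privacy is stated.\<close>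

lemma scale_measure_exp_le_iff:
  fixes M N :: "'b measure"
  assumes "finite_measure M" "finite_measure N" "sets M = sets N"
  shows "scale_measure (ennreal (exp a)) M \<le> scale_measure (ennreal (exp b)) N \<longleftrightarrow>
    (\<forall>S\<in>sets N. exp a * measure M S \<le> exp b * measure N S)"
proof -
  interpret M: finite_measure M by fact
  interpret N: finite_measure N by fact
  have "emeasure (scale_measure (ennreal (exp a)) M) S \<le> emeasure (scale_measure (ennreal (exp b)) N) S
      \<longleftrightarrow> exp a * measure M S \<le> exp b * measure N S" for S
    by (simp add: M.emeasure_eq_measure N.emeasure_eq_measure flip: ennreal_mult)
  then show ?thesis
    using assms(3) by (simp add: le_measure)
qed

lemma prob_space_scale_measure:
  assumes "finite_measure M" "measure M (space M) > 0"
  shows "prob_space (scale_measure (ennreal (1 / measure M (space M))) M)"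
proof
  interpret finite_measure M by fact
  show "emeasure (scale_measure (ennreal (1 / measure M (space M))) M)
      (space (scale_measure (ennreal (1 / measure M (space M))) M)) = 1"
    using assms(2) by (simp add: space_scale_measure emeasure_eq_measure flip: ennreal_mult)
qed

text \<open>\<open>H\<close> is taken nonempty because the infimum over an empty family is the top
  element of the lattice, which has no relation to \<open>\<Omega>\<close>.\<close>

locale private_algorithm = Metric_space M d
  for M :: "'a set" and d :: "'a \<Rightarrow> 'a \<Rightarrow> real" +
  fixes \<Omega> :: "'b measure" and \<epsilon> :: real and H :: "'a set" and Ahat :: "'a \<Rightarrow> 'b measure"
  assumes eps: "\<epsilon> > 0"
    and subset: "H \<subseteq> M"
    and nonempty: "H \<noteq> {}"
    and algorithm: "randomized_algorithm H \<Omega> Ahat"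
    and privacy: "differentially_private \<epsilon> d H \<Omega> Ahat"
begin

text \<open>The infimum is that of the lattice, since a setwise infimum of measures need not be
  additive.\<close>

definition envelope :: "'a \<Rightarrow> 'b measure" where
  "envelope D = (INF D'\<in>H. scale_measure (ennreal (exp (\<epsilon> * d D D'))) (Ahat D'))"

lemma prob_Ahat: "D \<in> H \<Longrightarrow> prob_space (Ahat D)"
  and sets_Ahat: "D \<in> H \<Longrightarrow> sets (Ahat D) = sets \<Omega>"
  using algorithm by (auto simp: randomized_algorithm_def)

lemma envelope_lower:
  "D' \<in> H \<Longrightarrow> envelope D \<le> scale_measure (ennreal (exp (\<epsilon> * d D D'))) (Ahat D')"
  unfolding envelope_def by (rule INF_lower)

text \<open>Privacy compares \<open>Ahat E\<close> with each \<open>Ahat D'\<close> at cost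
  \<open>d E D'\<close>, and \<open>d E D' - d D E \<le> d D D'\<close> by the triangle inequality.
  Together with \<open>envelope_lower\<close> this fixes the sigma-algebra, makes the total mass
  positive and identifies the envelope on \<open>H\<close>.\<close>

lemma envelope_ge:
  assumes "D \<in> M" "E \<in> H"
  shows "scale_measure (ennreal (exp (- \<epsilon> * d D E))) (Ahat E) \<le> envelope D"
  unfolding envelope_def
proof (rule INF_greatest)
  fix D' assume D': "D' \<in> H"
  have "exp (- \<epsilon> * d D E) * measure (Ahat E) S \<le> exp (\<epsilon> * d D D') * measure (Ahat D') S"
    if "S \<in> sets \<Omega>" for S
  proof -
    have "exp (- \<epsilon> * d D E) * measure (Ahat E) S
        \<le> exp (- \<epsilon> * d D E) * (exp (\<epsilon> * d E D') * measure (Ahat D') S)"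
      using privacy that assms(2) D' by (simp add: differentially_private_def)
    also have "\<dots> = exp (\<epsilon> * (d E D' - d D E)) * measure (Ahat D') S"
      by (simp add: right_diff_distrib exp_diff exp_minus field_simps)
    also have "\<dots> \<le> exp (\<epsilon> * d D D') * measure (Ahat D') S"
    proof -
      have "d E D' - d D E \<le> d D D'"
        using triangle[of E D D'] commute[of D E] assms D' subset by (simp add: subset_iff)
      then show ?thesis
        using eps by (intro mult_right_mono) auto
    qed
    finally show ?thesis .
  qed
  then show "scale_measure (ennreal (exp (- \<epsilon> * d D E))) (Ahat E)
      \<le> scale_measure (ennreal (exp (\<epsilon> * d D D'))) (Ahat D')"
    using assms(2) D' prob_Ahat
    by (subst scale_measure_exp_le_iff) (auto simp: sets_Ahat prob_space.finite_measure)
qed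

lemma sets_envelope:
  assumes "D \<in> M"
  shows "sets (envelope D) = sets \<Omega>"
proof -
  obtain E where "E \<in> H" using nonempty by blast
  then show ?thesis
    using sets_eq_of_le_of_le[OF envelope_ge envelope_lower] assms by (simp add: sets_Ahat)
qed

lemma space_envelope: "D \<in> M \<Longrightarrow> space (envelope D) = space \<Omega>"
  using sets_envelope by (rule sets_eq_imp_space_eq)

lemma finite_measure_envelope:
  assumes "D \<in> M"
  shows "finite_measure (envelope D)"
proof
  obtain E where E: "E \<in> H" using nonempty by blast
  have "emeasure (envelope D) (space (envelope D))
      \<le> emeasure (scale_measure (ennreal (exp (\<epsilon> * d D E))) (Ahat E)) (space (envelope D))"
    using E assms by (intro le_measureD3 envelope_lower) (simp_all add: sets_envelope sets_Ahat)
  also have "\<dots> < \<infinity>"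
    using prob_space.finite_measure[OF prob_Ahat[OF E]]
    by (simp add: finite_measure.emeasure_eq_measure flip: ennreal_mult)
  finally show "emeasure (envelope D) (space (envelope D)) \<noteq> \<infinity>" by simp
qed

lemma measure_envelope_pos:
  assumes "D \<in> M"
  shows "measure (envelope D) (space (envelope D)) > 0"
proof -
  obtain E where E: "E \<in> H" using nonempty by blast
  interpret env: finite_measure "envelope D" by (rule finite_measure_envelope) fact
  have "space (envelope D) = space (Ahat E)"
    using E assms by (intro sets_eq_imp_space_eq) (simp add: sets_envelope sets_Ahat)
  then have "0 < emeasure (scale_measure (ennreal (exp (- \<epsilon> * d D E))) (Ahat E)) (space (envelope D))"
    using prob_space.emeasure_space_1[OF prob_Ahat[OF E]] by simp
  also have "\<dots> \<le> emeasure (envelope D) (space (envelope D))"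
    using E assms by (intro le_measureD3 envelope_ge) (simp_all add: sets_envelope sets_Ahat)
  finally show ?thesis
    by (simp add: env.emeasure_eq_measure)
qed

text \<open>Taking \<open>D\<close> itself as the comparison point makes both scaling factors equal
  to 1, so the upper and lower bounds coincide.\<close>

lemma envelope_eq:
  assumes "D \<in> H"
  shows "envelope D = Ahat D"
proof (rule antisym)
  have [simp]: "d D D = 0" using assms subset by auto
  show "envelope D \<le> Ahat D" using envelope_lower[OF assms, of D] by simp
  show "Ahat D \<le> envelope D" using envelope_ge[of D D] assms subset by auto
qed

lemma envelope_le:
  assumes "D \<in> M" "E \<in> M" "S \<in> sets \<Omega>"
  shows "measure (envelope D) S \<le> exp (\<epsilon> * d D E) * measure (envelope E) S"
proof -
  \<comment> \<open>The factor is moved to the left so that a bare infimum stands on the right and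
    \<open>INF_greatest\<close> applies. The factor \<open>exp 0\<close> gives the inequality the
    shape of \<open>scale_measure_exp_le_iff\<close>.\<close>
  have "scale_measure (ennreal (exp (- (\<epsilon> * d D E)))) (envelope D)
      \<le> scale_measure (ennreal (exp 0)) (envelope E)"
    unfolding envelope_def[of E] exp_zero ennreal_1 scale_measure_1
  proof (rule INF_greatest)
    fix D' assume D': "D' \<in> H"
    interpret D': prob_space "Ahat D'" using D' by (rule prob_Ahat)
    interpret env: finite_measure "envelope D" by (rule finite_measure_envelope) fact
    have "exp (- (\<epsilon> * d D E)) * measure (envelope D) S \<le> exp (\<epsilon> * d E D') * measure (Ahat D') S" for S
    proof -
      have "emeasure (envelope D) S \<le> emeasure (scale_measure (ennreal (exp (\<epsilon> * d D D'))) (Ahat D')) S"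
        using D' assms by (intro le_measureD3 envelope_lower) (simp_all add: sets_envelope sets_Ahat)
      then have "measure (envelope D) S \<le> exp (\<epsilon> * d D D') * measure (Ahat D') S"
        by (simp add: env.emeasure_eq_measure D'.emeasure_eq_measure flip: ennreal_mult)
      also have "\<dots> \<le> exp (\<epsilon> * (d D E + d E D')) * measure (Ahat D') S"
        using triangle[of D E D'] assms D' subset eps by (intro mult_right_mono) auto
      finally show ?thesis
        by (simp add: distrib_left exp_add exp_minus field_simps)
    qed
    then show "scale_measure (ennreal (exp (- (\<epsilon> * d D E)))) (envelope D)
        \<le> scale_measure (ennreal (exp (\<epsilon> * d E D'))) (Ahat D')"
      using D' assms
      by (subst scale_measure_exp_le_iff)
        (auto simp: sets_envelope sets_Ahat env.finite_measure_axioms D'.finite_measure_axioms)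
  qed
  then have "exp (- (\<epsilon> * d D E)) * measure (envelope D) S \<le> exp 0 * measure (envelope E) S"
    using assms by (subst (asm) scale_measure_exp_le_iff) (auto simp: sets_envelope finite_measure_envelope)
  then show ?thesis
    by (simp add: exp_minus field_simps)
qed

definition extension :: "'a \<Rightarrow> 'b measure" where
  "extension D = scale_measure (ennreal (1 / measure (envelope D) (space (envelope D)))) (envelope D)"

lemma randomized_algorithm_extension: "randomized_algorithm M \<Omega> extension"
  by (auto simp: randomized_algorithm_def extension_def sets_envelope
      intro!: prob_space_scale_measure finite_measure_envelope measure_envelope_pos)

text \<open>On \<open>H\<close> the envelope already has mass one, so normalising changes
  nothing.\<close>

lemma extension_eq: "D \<in> H \<Longrightarrow> extension D = Ahat D"
  using prob_Ahat by (simp add: extension_def envelope_eq prob_space.prob_space)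

lemma differentially_private_extension: "differentially_private (2 * \<epsilon>) d M \<Omega> extension"
  unfolding differentially_private_def
proof (intro ballI)
  fix S D E assume S: "S \<in> sets \<Omega>" and D: "D \<in> M" and E: "E \<in> M"
  define k where "k = exp (\<epsilon> * d D E)"
  define m where "m X = measure (envelope X)" for X
  have pos: "0 < k" "0 < m D (space \<Omega>)" "0 < m E (space \<Omega>)" "0 \<le> m E S"
    using measure_envelope_pos[OF D] measure_envelope_pos[OF E] D E
    by (simp_all add: k_def m_def space_envelope)
  have ext: "measure (extension X) S = m X S / m X (space \<Omega>)" if "X \<in> M" for X
    using that by (simp add: extension_def m_def space_envelope)
  \<comment> \<open>The envelope bound with \<open>D\<close> and \<open>E\<close> exchanged, on the
    whole space, bounds the normalising denominator from below. This is the source of the second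
    factor \<open>k\<close>.\<close>
  have "m E (space \<Omega>) \<le> k * m D (space \<Omega>)"
    using envelope_le[OF E D sets.top] commute[of D E] by (simp add: k_def m_def)
  then have "m D S / m D (space \<Omega>) \<le> (k * m E S) / (m E (space \<Omega>) / k)"
    using envelope_le[OF D E S] pos by (intro frac_le) (auto simp: k_def m_def field_simps)
  also have "\<dots> = k\<^sup>2 * (m E S / m E (space \<Omega>))"
    by (simp add: power2_eq_square)
  also have "k\<^sup>2 = exp (2 * \<epsilon> * d D E)"
    by (simp add: k_def mult.assoc exp_double)
  finally show "measure (extension D) S \<le> exp (2 * \<epsilon> * d D E) * measure (extension E) S"
    using D E by (simp add: ext)
qed

end

theorem proposition5p1:
  fixes M :: "'a set" and d :: "'a \<Rightarrow> 'a \<Rightarrow> real"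
    and \<Omega> :: "'b measure" and \<epsilon> :: real
    and H :: "'a set" and Ahat :: "'a \<Rightarrow> 'b measure"
  assumes "Metric_space M d"
    and "space \<Omega> \<noteq> {}"
    and "\<epsilon> > 0"
    and "H \<subseteq> M"
    and "randomized_algorithm H \<Omega> Ahat"
    and "differentially_private \<epsilon> d H \<Omega> Ahat"
  shows "\<exists>A. randomized_algorithm M \<Omega> A
           \<and> differentially_private (2 * \<epsilon>) d M \<Omega> A
           \<and> (\<forall>D\<in>H. A D = Ahat D)"
proof (cases "H = {}")
  case True
  interpret Metric_space M d by fact
  \<comment> \<open>With nothing to extend, a constant algorithm suffices: a point mass at any
    outcome, private because \<open>d\<close> is nonnegative and so the exponential factor is at
    least 1.\<close>
  obtain \<omega> where "\<omega> \<in> space \<Omega>" using assms(2) by blast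
  then have "randomized_algorithm M \<Omega> (\<lambda>_. return \<Omega> \<omega>)"
    by (simp add: randomized_algorithm_def prob_space_return)
  moreover have "differentially_private (2 * \<epsilon>) d M \<Omega> (\<lambda>_. return \<Omega> \<omega>)"
    using assms(3) by (auto simp: differentially_private_def mult_le_cancel_right1)
  ultimately show ?thesis
    using True by blast
next
  case False
  interpret private_algorithm M d \<Omega> \<epsilon> H Ahat
    using assms False by (simp add: private_algorithm_def private_algorithm_axioms_def)
  show ?thesis
    using randomized_algorithm_extension differentially_private_extension extension_eq by blast
qed

end
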